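(* Let $\{(G_i,T_i)\}_{i\in I}$ be a family of topo-compact topo-groups. Then the direct product $G=\prod_{i\in I}G_i$, equipped with the product topo-system, is also topo-compact.
   Context: A topo-system on a group $G$ is a set $T$ of subgroups of $G$ such that: (a) $1\in T$ and $G\in T$ (where $1$ is the trivial subgroup); (b) if $\{A_i\}_{i\in I}$ is a family of elements of $T$, then the subgroup generated by them $\langle A_i : i\in I\rangle$ belongs to $T$; (c) if $A,B\in T$ then $A\cap B\in T$. The pair $(G,T)$ is then called a topo-group, and elements of $T$ are called topen subgroups. A topo-group $(G,T)$ is topo-compact if every covering of $G$ by topen subgroups has a finite sub-covering: whenever $G=\bigcup_{i\in I}A_i$ with all $A_i\in T$, there is a finite $J\subseteq I$ with $G=\bigcup_{i\in J}A_i$. For a family $\{(G_i,T_i)\}_{i\in I}$ of topo-groups, $\prod_{i\in I}G_i$ is the full (unrestricted) direct product, and the product topo-system on it is the set of all subgroups $\prod_{i\in I}A_i$ with $A_i\in T_i$ for all $i$ and $A_i=G_i$ for all but finitely many $i$, together with the trivial subgroup. *)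

theory Defs
  imports "HOL-Algebra.Product_Groups" "HOL-Algebra.Generated_Groups"
begin

text \<open>
  Families of topen subgroups are represented by sets of subgroups: both the generated
  subgroup and the union depend only on the range of the family. The empty family
  is allowed; it generates the trivial subgroup.
\<close>

locale topo_group = group G for G (structure) and T :: "'a set set" +
  assumes topen_subgroup: "A \<in> T \<Longrightarrow> subgroup A G"
    and trivial_topen: "{\<one>} \<in> T"
    and carrier_topen: "carrier G \<in> T"
    and generate_topen: "\<A> \<subseteq> T \<Longrightarrow> generate G (\<Union>\<A>) \<in> T"
    and Int_topen: "A \<in> T \<Longrightarrow> B \<in> T \<Longrightarrow> A \<inter> B \<in> T"

locale topo_compact_group = topo_group +
  assumes topo_compact:
    "\<C> \<subseteq> T \<Longrightarrow> carrier G = \<Union>\<C> \<Longrightarrow>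
       \<exists>\<D>. finite \<D> \<and> \<D> \<subseteq> \<C> \<and> carrier G = \<Union>\<D>"

definition product_topo_system ::
    "'i set \<Rightarrow> ('i \<Rightarrow> ('a, 'b) monoid_scheme) \<Rightarrow> ('i \<Rightarrow> 'a set set) \<Rightarrow> ('i \<Rightarrow> 'a) set set" where
  "product_topo_system I G T =
     {Pi\<^sub>E I A | A. (\<forall>i\<in>I. A i \<in> T i) \<and> finite {i \<in> I. A i \<noteq> carrier (G i)}}
     \<union> {{\<one>\<^bsub>product_group I G\<^esub>}}"

end

theory Submission
  imports Defs "HOL-Analysis.Function_Topology"
begin

text \<open>
  The topen subgroups of a topo-group are closed under binary intersections and contain the whole
  group, so they form a base of an ordinary topology on its carrier, and topo-compactness says
  that covers by basic open sets have finite subcovers, which is compactness of that topology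
  (\<open>compact_space_topen_topology\<close>). Every box in the product topo-system is open in
  the product of these topologies, so Tychonoff's theorem gives finite subcovers for all covers by
  boxes (\<open>finite_box_subcover\<close>). The one member of the product topo-system that
  need not be open is the trivial subgroup. It is harmless: every subgroup contains the identity,
  so the trivial subgroup can be dropped from any cover that has another member, and a cover
  without another member is finite already.

  The product topo-system must also be shown to be a topo-system, where the only
  axiom with content is closure under generation: a family of boxes generates the box of
  the subgroups generated in each coordinate (\<open>generate_boxes\<close>). In an infinite product,
  the subgroup generated by all the axes is only the restricted product, and the claim
  rests on one box of the family filling all but finitely many coordinates.
\<close>

section \<open>Subgroups generated by boxes\<close>

definition axis_embedding ::
    "'i set \<Rightarrow> ('i \<Rightarrow> ('a, 'b) monoid_scheme) \<Rightarrow> 'i \<Rightarrow> 'a \<Rightarrow> 'i \<Rightarrow> 'a" where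
  "axis_embedding I G i g = (\<lambda>j\<in>I. if j = i then g else \<one>\<^bsub>G j\<^esub>)"

lemma group_hom_axis_embedding:
  assumes G: "\<And>i. i \<in> I \<Longrightarrow> group (G i)" and i: "i \<in> I"
  shows "group_hom (G i) (product_group I G) (axis_embedding I G i)"
proof -
  have mon: "monoid (G j)" if "j \<in> I" for j
    using G that by (simp add: group.is_monoid)
  have "axis_embedding I G i \<in> hom (G i) (product_group I G)"
    by (rule homI) (auto simp: axis_embedding_def mon monoid.l_one fun_eq_iff)
  then show ?thesis
    using G i by (simp add: group_hom_def group_hom_axioms_def)
qed

text \<open>
  Membership in a subgroup of the product can be checked coordinate by coordinate on a finite set,
  because \<open>x\<close> is the finite product of its components along the axes in \<open>F\<close>
  and of the element that agrees with it off \<open>F\<close>.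
\<close>
lemma mem_subgroup_product_group:
  assumes G: "\<And>i. i \<in> I \<Longrightarrow> group (G i)"
    and K: "subgroup K (product_group I G)"
    and F: "finite F" "F \<subseteq> I"
    and x: "x \<in> (\<Pi>\<^sub>E i\<in>I. carrier (G i))"
    and axis: "\<And>i. i \<in> F \<Longrightarrow> axis_embedding I G i (x i) \<in> K"
    and rest: "(\<lambda>i\<in>I. if i \<in> F then \<one>\<^bsub>G i\<^esub> else x i) \<in> K"
  shows "x \<in> K"
  using F x axis rest
proof (induction F arbitrary: x rule: finite_induct)
  case empty
  then have "(\<lambda>i\<in>I. if i \<in> {} then \<one>\<^bsub>G i\<^esub> else x i) = x"
    by (auto simp: fun_eq_iff PiE_iff extensional_def)
  with empty show ?case by simp
next
  case (insert i F)
  have mon: "monoid (G j)" if "j \<in> I" for j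
    using G that by (simp add: group.is_monoid)
  define y where "y = x(i := \<one>\<^bsub>G i\<^esub>)"
  have i: "i \<in> I" using insert.prems by simp
  have y: "y \<in> (\<Pi>\<^sub>E j\<in>I. carrier (G j))"
    using insert.prems i mon by (auto simp: y_def PiE_iff extensional_def)
  have "(\<lambda>j\<in>I. if j \<in> F then \<one>\<^bsub>G j\<^esub> else y j)
      = (\<lambda>j\<in>I. if j \<in> insert i F then \<one>\<^bsub>G j\<^esub> else x j)"
    by (auto simp: y_def fun_eq_iff)
  moreover have "axis_embedding I G j (y j) \<in> K" if "j \<in> F" for j
    using insert.prems(3)[of j] that insert.hyps by (auto simp: y_def)
  ultimately have "y \<in> K"
    using insert.IH[OF _ y] insert.prems by simp
  moreover have "x = axis_embedding I G i (x i) \<otimes>\<^bsub>product_group I G\<^esub> y"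
    using insert.prems(2) i mon
    by (auto simp: axis_embedding_def y_def fun_eq_iff PiE_iff extensional_def
        monoid.l_one monoid.r_one Pi_iff)
  ultimately show ?case
    using insert.prems(3)[of i] subgroup.m_closed[OF K] by (metis insertI1)
qed

text \<open>
  For the nontrivial inclusion, let \<open>F\<close> be the finite set of coordinates in which
  \<open>A0\<close> is proper. Off \<open>F\<close> an arbitrary element already lies in the box of
  \<open>A0\<close>. Along an axis, every box contains the embedded copy of its factor, so the
  generated subgroup contains the embedded copy of what these factors generate. The
  finitely many components from \<open>F\<close> are then put together by
  \<open>mem_subgroup_product_group\<close>.
\<close>
lemma generate_boxes:
  assumes G: "\<And>i. i \<in> I \<Longrightarrow> group (G i)"
    and sub: "\<And>A i. A \<in> \<B> \<Longrightarrow> i \<in> I \<Longrightarrow> subgroup (A i) (G i)"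
    and A0: "A0 \<in> \<B>" "finite {i \<in> I. A0 i \<noteq> carrier (G i)}"
  shows "generate (product_group I G) (\<Union>A\<in>\<B>. Pi\<^sub>E I A)
       = (\<Pi>\<^sub>E i\<in>I. generate (G i) (\<Union>A\<in>\<B>. A i))"
    (is "generate ?P ?U = (\<Pi>\<^sub>E i\<in>I. ?H i)")
proof (rule subset_antisym)
  interpret P: group ?P using G by simp
  have sub_carrier: "(\<Union>A\<in>\<B>. A i) \<subseteq> carrier (G i)" if "i \<in> I" for i
    using sub[OF _ that] subgroup.subset by blast
  have H: "subgroup (?H i) (G i)" if "i \<in> I" for i
    using group.generate_is_subgroup[OF G[OF that] sub_carrier[OF that]] .
  show "generate ?P ?U \<subseteq> (\<Pi>\<^sub>E i\<in>I. ?H i)"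
  proof (rule P.generate_subgroup_incl)
    show "?U \<subseteq> (\<Pi>\<^sub>E i\<in>I. ?H i)"
      by (auto simp: PiE_iff intro!: generate.incl)
    show "subgroup (\<Pi>\<^sub>E i\<in>I. ?H i) ?P"
      using G H by (simp add: PiE_subgroup_product_group)
  qed
  have "?U \<subseteq> carrier ?P"
    unfolding carrier_product_group by (intro UN_least PiE_mono) (use sub_carrier in blast)
  then have K: "subgroup (generate ?P ?U) ?P"
    by (rule P.generate_is_subgroup)
  show "(\<Pi>\<^sub>E i\<in>I. ?H i) \<subseteq> generate ?P ?U"
  proof
    fix x assume x: "x \<in> (\<Pi>\<^sub>E i\<in>I. ?H i)"
    let ?F = "{i \<in> I. A0 i \<noteq> carrier (G i)}"
    show "x \<in> generate ?P ?U"
    proof (rule mem_subgroup_product_group[OF G K A0(2)])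
      show "?F \<subseteq> I" by blast
      show x_carrier: "x \<in> (\<Pi>\<^sub>E i\<in>I. carrier (G i))"
        using x PiE_mono[of I ?H "\<lambda>i. carrier (G i)"] H subgroup.subset by blast
      show "axis_embedding I G i (x i) \<in> generate ?P ?U" if "i \<in> ?F" for i
      proof -
        have i: "i \<in> I" using that by simp
        interpret group_hom "G i" ?P "axis_embedding I G i"
          using G i by (rule group_hom_axis_embedding)
        have "axis_embedding I G i ` (\<Union>A\<in>\<B>. A i) \<subseteq> ?U"
          using sub by (fastforce simp: axis_embedding_def PiE_iff subgroup.one_closed)
        then have "axis_embedding I G i ` ?H i \<subseteq> generate ?P ?U"
          using generate_img[OF sub_carrier[OF i]] P.mono_generate by metis
        moreover have "x i \<in> ?H i"
          using x i by auto
        ultimately show ?thesis by blast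
      qed
      have "(\<lambda>i\<in>I. if i \<in> ?F then \<one>\<^bsub>G i\<^esub> else x i) \<in> Pi\<^sub>E I A0"
        using x_carrier sub[OF A0(1)] by (auto simp: PiE_iff subgroup.one_closed)
      then show "(\<lambda>i\<in>I. if i \<in> ?F then \<one>\<^bsub>G i\<^esub> else x i) \<in> generate ?P ?U"
        using A0(1) by (blast intro: generate.incl)
    qed
  qed
qed

section \<open>The product topo-system\<close>

definition topen_box ::
    "'i set \<Rightarrow> ('i \<Rightarrow> ('a, 'b) monoid_scheme) \<Rightarrow> ('i \<Rightarrow> 'a set set) \<Rightarrow> ('i \<Rightarrow> 'a set) \<Rightarrow> bool" where
  "topen_box I G T A \<longleftrightarrow> (\<forall>i\<in>I. A i \<in> T i) \<and> finite {i \<in> I. A i \<noteq> carrier (G i)}"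

lemma product_topo_system_cases:
  assumes "X \<in> product_topo_system I G T"
  obtains (trivial) "X = {\<one>\<^bsub>product_group I G\<^esub>}"
    | (box) A where "topen_box I G T A" "X = Pi\<^sub>E I A"
  using assms by (auto simp: product_topo_system_def topen_box_def)

lemma trivial_mem_product_topo_system:
  "{\<one>\<^bsub>product_group I G\<^esub>} \<in> product_topo_system I G T"
  by (simp add: product_topo_system_def)

lemma box_mem_product_topo_system:
  "topen_box I G T A \<Longrightarrow> Pi\<^sub>E I A \<in> product_topo_system I G T"
  by (auto simp: product_topo_system_def topen_box_def)

lemma subgroup_mem_product_topo_system:
  assumes T: "\<And>i. i \<in> I \<Longrightarrow> topo_group (G i) (T i)"
    and X: "X \<in> product_topo_system I G T"
  shows "subgroup X (product_group I G)"
proof -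
  have G: "group (G i)" if "i \<in> I" for i
    using T[OF that] by (simp add: topo_group_def)
  from X show ?thesis
  proof (cases rule: product_topo_system_cases)
    case trivial
    then show ?thesis
      using G group.triv_subgroup[OF product_group] by metis
  next
    case (box A)
    have "subgroup (A i) (G i)" if "i \<in> I" for i
      using box(1) topo_group.topen_subgroup[OF T[OF that]] that by (simp add: topen_box_def)
    then show ?thesis
      using G box(2) by (simp add: PiE_subgroup_product_group)
  qed
qed

lemma topo_group_product_group:
  assumes T: "\<And>i. i \<in> I \<Longrightarrow> topo_group (G i) (T i)"
  shows "topo_group (product_group I G) (product_topo_system I G T)"
    (is "topo_group ?P ?S")
proof -
  have G: "group (G i)" if "i \<in> I" for i
    using T[OF that] by (simp add: topo_group_def)
  interpret P: group ?P using G by simp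
  have sub: "subgroup X ?P" if "X \<in> ?S" for X
    using subgroup_mem_product_topo_system[OF T that] .
  show ?thesis
  proof (rule topo_group.intro[OF P.group_axioms topo_group_axioms.intro])
    show "carrier ?P \<in> ?S"
      unfolding carrier_product_group
      by (rule box_mem_product_topo_system) (simp add: topen_box_def T topo_group.carrier_topen)
  next
    fix \<A> assume \<A>: "\<A> \<subseteq> ?S"
    define \<B> where "\<B> = {A. topen_box I G T A \<and> Pi\<^sub>E I A \<in> \<A>}"
    \<comment> \<open>If no box occurs in the family, it generates the trivial subgroup, which need not be a
      box. Otherwise the trivial subgroup adds nothing to the union of the boxes.\<close>
    show "generate ?P (\<Union>\<A>) \<in> ?S"
    proof (cases "\<B> = {}")
      case True
      then have "\<Union>\<A> \<subseteq> {\<one>\<^bsub>?P\<^esub>}"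
        using \<A> by (fastforce simp: \<B>_def elim: product_topo_system_cases)
      then have "generate ?P (\<Union>\<A>) = {\<one>\<^bsub>?P\<^esub>}"
        by (intro subset_antisym P.generate_subgroup_incl P.triv_subgroup)
          (simp_all only: empty_subsetI insert_subset generate.one simp_thms)
      then show ?thesis by (metis trivial_mem_product_topo_system)
    next
      case False
      then obtain A0 where A0: "A0 \<in> \<B>" by blast
      have subB: "subgroup (A i) (G i)" if "A \<in> \<B>" "i \<in> I" for A i
        using that topo_group.topen_subgroup[OF T[OF that(2)]] by (simp add: \<B>_def topen_box_def)
      have "\<one>\<^bsub>?P\<^esub> \<in> Pi\<^sub>E I A0"
        using subB[OF A0] by (simp add: subgroup.one_closed)
      then have trivial_sub: "{\<one>\<^bsub>?P\<^esub>} \<subseteq> Pi\<^sub>E I A0"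
        by blast
      have union_eq: "\<Union>\<A> = (\<Union>A\<in>\<B>. Pi\<^sub>E I A)"
      proof
        have "X \<subseteq> (\<Union>A\<in>\<B>. Pi\<^sub>E I A)" if X: "X \<in> \<A>" for X
        proof -
          have "X \<in> ?S" using X \<A> by blast
          then show ?thesis
          proof (cases rule: product_topo_system_cases)
            case trivial
            with trivial_sub A0 show ?thesis by blast
          next
            case (box A)
            with X have "A \<in> \<B>" by (simp add: \<B>_def)
            with box show ?thesis by blast
          qed
        qed
        then show "\<Union>\<A> \<subseteq> (\<Union>A\<in>\<B>. Pi\<^sub>E I A)" by (rule Union_least)
        show "(\<Union>A\<in>\<B>. Pi\<^sub>E I A) \<subseteq> \<Union>\<A>"
          unfolding \<B>_def by blast
      qed
      have A0fin: "finite {i \<in> I. A0 i \<noteq> carrier (G i)}"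
        using A0 by (simp add: \<B>_def topen_box_def)
      have gen: "generate ?P (\<Union>\<A>) = (\<Pi>\<^sub>E i\<in>I. generate (G i) (\<Union>A\<in>\<B>. A i))"
        unfolding union_eq by (rule generate_boxes) (fact G subB A0 A0fin)+
      have "topen_box I G T (\<lambda>i. generate (G i) (\<Union>A\<in>\<B>. A i))"
        unfolding topen_box_def
      proof (intro conjI ballI)
        fix i assume i: "i \<in> I"
        have "(\<lambda>A. A i) ` \<B> \<subseteq> T i"
          using i by (auto simp: \<B>_def topen_box_def)
        then show "generate (G i) (\<Union>A\<in>\<B>. A i) \<in> T i"
          by (rule topo_group.generate_topen[OF T[OF i]])
      next
        have "generate (G i) (\<Union>A\<in>\<B>. A i) = carrier (G i)"
          if i: "i \<in> I" and full: "A0 i = carrier (G i)" for i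
        proof
          show "generate (G i) (\<Union>A\<in>\<B>. A i) \<subseteq> carrier (G i)"
            using group.generate_incl[OF G[OF i]] subB[OF _ i] subgroup.subset
            by (metis (no_types, lifting) UN_least)
          show "carrier (G i) \<subseteq> generate (G i) (\<Union>A\<in>\<B>. A i)"
            using A0 full by (blast intro: generate.incl)
        qed
        then show "finite {i \<in> I. generate (G i) (\<Union>A\<in>\<B>. A i) \<noteq> carrier (G i)}"
          by (blast intro: finite_subset[OF _ A0fin])
      qed
      then show ?thesis
        unfolding gen by (rule box_mem_product_topo_system)
    qed
  next
    fix X Y assume X: "X \<in> ?S" and Y: "Y \<in> ?S"
    have one: "\<one>\<^bsub>?P\<^esub> \<in> X" "\<one>\<^bsub>?P\<^esub> \<in> Y"
      using sub[OF X] sub[OF Y] by (auto dest: subgroup.one_closed simp del: one_product_group)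
    show "X \<inter> Y \<in> ?S"
    proof (cases "X = {\<one>\<^bsub>?P\<^esub>} \<or> Y = {\<one>\<^bsub>?P\<^esub>}")
      case True
      then have "X \<inter> Y = {\<one>\<^bsub>?P\<^esub>}" using one by blast
      then show ?thesis by (metis trivial_mem_product_topo_system)
    next
      case False
      then obtain A B where A: "topen_box I G T A" "X = Pi\<^sub>E I A"
        and B: "topen_box I G T B" "Y = Pi\<^sub>E I B"
        using product_topo_system_cases[OF X] product_topo_system_cases[OF Y] by metis
      have "{i \<in> I. A i \<inter> B i \<noteq> carrier (G i)}
          \<subseteq> {i \<in> I. A i \<noteq> carrier (G i)} \<union> {i \<in> I. B i \<noteq> carrier (G i)}"
        by auto
      then have "topen_box I G T (\<lambda>i. A i \<inter> B i)"
        using A(1) B(1) topo_group.Int_topen[OF T]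
        by (auto simp: topen_box_def intro: finite_subset)
      then show ?thesis
        unfolding A(2) B(2) PiE_Int by (rule box_mem_product_topo_system)
    qed
  qed (fact sub trivial_mem_product_topo_system)+
qed

section \<open>Compactness of the product\<close>

text \<open>
  Meaningful when \<open>T\<close> is closed under binary intersections, as it is in a topo-group:
  then unions of members of \<open>T\<close> are themselves closed under binary intersections.
\<close>
definition topen_topology :: "'a set set \<Rightarrow> 'a topology" where
  "topen_topology T = topology (arbitrary union_of (\<lambda>A. A \<in> T))"

lemma (in topo_group) openin_topen_topology:
  "openin (topen_topology T) U \<longleftrightarrow> (\<exists>\<A>\<subseteq>T. \<Union>\<A> = U)"
proof -
  have "istopology (arbitrary union_of (\<lambda>A. A \<in> T))"
    by (rule istopology_base) (rule Int_topen)
  then show ?thesis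
    unfolding topen_topology_def by (auto simp: topology_inverse' union_of_def arbitrary_def)
qed

lemma (in topo_group) openin_topen:
  "A \<in> T \<Longrightarrow> openin (topen_topology T) A"
  by (auto simp: openin_topen_topology intro: exI[of _ "{A}"])

lemma (in topo_group) topspace_topen_topology [simp]:
  "topspace (topen_topology T) = carrier G"
proof
  show "topspace (topen_topology T) \<subseteq> carrier G"
    using openin_topspace[of "topen_topology T"] topen_subgroup subgroup.subset
    unfolding openin_topen_topology by blast
  show "carrier G \<subseteq> topspace (topen_topology T)"
    using openin_topen[OF carrier_topen] by (rule openin_subset)
qed

lemma (in topo_compact_group) compact_space_topen_topology:
  "compact_space (topen_topology T)"
  unfolding compact_space topspace_topen_topology
proof (intro allI impI, elim conjE)
  fix \<U> assume open_\<U>: "\<forall>U\<in>\<U>. openin (topen_topology T) U" and cover: "\<Union>\<U> = carrier G"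
  \<comment> \<open>The topen subgroups subordinate to the cover still cover, as every open set is a
    union of topen subgroups.\<close>
  define \<C> where "\<C> = {A \<in> T. \<exists>U\<in>\<U>. A \<subseteq> U}"
  have "\<Union>\<C> = \<Union>\<U>"
  proof
    show "\<Union>\<U> \<subseteq> \<Union>\<C>"
    proof
      fix x assume "x \<in> \<Union>\<U>"
      then obtain U where U: "U \<in> \<U>" "x \<in> U" by blast
      then have "openin (topen_topology T) U"
        using open_\<U> by blast
      then obtain \<A> where "\<A> \<subseteq> T" "\<Union>\<A> = U"
        unfolding openin_topen_topology by blast
      with U show "x \<in> \<Union>\<C>"
        by (auto simp: \<C>_def)
    qed
  qed (auto simp: \<C>_def)
  then have "carrier G = \<Union>\<C>" using cover by simp
  moreover have "\<C> \<subseteq> T" by (auto simp: \<C>_def)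
  ultimately obtain \<D> where \<D>: "finite \<D>" "\<D> \<subseteq> \<C>" "carrier G = \<Union>\<D>"
    using topo_compact by metis
  have "\<forall>A\<in>\<D>. \<exists>U\<in>\<U>. A \<subseteq> U"
    using \<D>(2) by (auto simp: \<C>_def)
  then obtain u where u: "\<And>A. A \<in> \<D> \<Longrightarrow> u A \<in> \<U> \<and> A \<subseteq> u A"
    by metis
  show "\<exists>\<F>. finite \<F> \<and> \<F> \<subseteq> \<U> \<and> \<Union>\<F> = carrier G"
  proof (intro exI conjI)
    show "finite (u ` \<D>)" using \<D>(1) by (rule finite_imageI)
    show sub: "u ` \<D> \<subseteq> \<U>" using u by blast
    show "\<Union>(u ` \<D>) = carrier G"
    proof
      show "\<Union>(u ` \<D>) \<subseteq> carrier G"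
        using Union_mono[OF sub] cover by simp
      show "carrier G \<subseteq> \<Union>(u ` \<D>)"
        unfolding \<D>(3) using u by blast
    qed
  qed
qed

text \<open>
  This is Tychonoff's theorem for the topologies generated by the topen subgroups: a box of open
  sets is open in the product topology because all but finitely many of its sides are full.
\<close>
lemma finite_box_subcover:
  assumes T: "\<And>i. i \<in> I \<Longrightarrow> topo_compact_group (G i) (T i)"
    and box: "\<And>X. X \<in> \<C> \<Longrightarrow> \<exists>A. topen_box I G T A \<and> X = Pi\<^sub>E I A"
    and cover: "\<Union>\<C> = (\<Pi>\<^sub>E i\<in>I. carrier (G i))"
  shows "\<exists>\<D>. finite \<D> \<and> \<D> \<subseteq> \<C> \<and> \<Union>\<D> = (\<Pi>\<^sub>E i\<in>I. carrier (G i))"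
proof -
  let ?X = "\<lambda>i. topen_topology (T i)"
  have topspace: "topspace (?X i) = carrier (G i)" if "i \<in> I" for i
    using topo_group.topspace_topen_topology T[OF that] topo_compact_group.axioms(1) by blast
  then have topspace_product: "topspace (product_topology ?X I) = (\<Pi>\<^sub>E i\<in>I. carrier (G i))"
    unfolding topspace_product_topology by (auto intro!: PiE_cong)
  have "compact_space (product_topology ?X I)"
    unfolding compact_space_product_topology
    using topo_compact_group.compact_space_topen_topology[OF T] by blast
  moreover have "openin (product_topology ?X I) X" if X: "X \<in> \<C>" for X
  proof -
    obtain A where A: "topen_box I G T A" "X = Pi\<^sub>E I A"
      using box[OF X] by blast
    have "{i \<in> I. A i \<noteq> topspace (?X i)} = {i \<in> I. A i \<noteq> carrier (G i)}"
      using topspace by auto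
    moreover have "openin (?X i) (A i)" if "i \<in> I" for i
      using A(1) topo_group.openin_topen[OF topo_compact_group.axioms(1)[OF T[OF that]]] that
      by (simp add: topen_box_def)
    ultimately show ?thesis
      using A by (simp add: openin_PiE_gen topen_box_def)
  qed
  ultimately show ?thesis
    using cover unfolding compact_space topspace_product by blast
qed

theorem theorem4p1:
  fixes I :: "'i set"
    and G :: "'i \<Rightarrow> ('a, 'b) monoid_scheme"
    and T :: "'i \<Rightarrow> 'a set set"
  assumes "\<And>i. i \<in> I \<Longrightarrow> topo_compact_group (G i) (T i)"
  shows "topo_compact_group (product_group I G) (product_topo_system I G T)"
proof -
  have T: "topo_group (G i) (T i)" if "i \<in> I" for i
    using assms[OF that] by (rule topo_compact_group.axioms(1))
  interpret topo_group "product_group I G" "product_topo_system I G T"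
    using T by (rule topo_group_product_group)
  let ?e = "\<one>\<^bsub>product_group I G\<^esub>"
  show ?thesis
  proof unfold_locales
    fix \<C> assume \<C>: "\<C> \<subseteq> product_topo_system I G T"
      and cover: "carrier (product_group I G) = \<Union>\<C>"
    show "\<exists>\<D>. finite \<D> \<and> \<D> \<subseteq> \<C> \<and> carrier (product_group I G) = \<Union>\<D>"
    proof (cases "\<C> \<subseteq> {{?e}}")
      case True
      then have "finite \<C>" by (rule finite_subset) simp
      with cover show ?thesis by blast
    next
      case False
      then obtain X where X: "X \<in> \<C>" "X \<noteq> {?e}" by blast
      then have "?e \<in> X"
        using \<C> topen_subgroup subgroup.one_closed by blast
      with X have "\<Union>(\<C> - {{?e}}) = \<Union>\<C>" by blast
      then have cover': "\<Union>(\<C> - {{?e}}) = (\<Pi>\<^sub>E i\<in>I. carrier (G i))"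
        using cover by simp
      have box: "\<exists>A. topen_box I G T A \<and> Y = Pi\<^sub>E I A" if "Y \<in> \<C> - {{?e}}" for Y
      proof -
        have "Y \<in> product_topo_system I G T" "Y \<noteq> {?e}"
          using that \<C> by blast+
        then show ?thesis
          by (cases rule: product_topo_system_cases) blast+
      qed
      obtain \<D> where "finite \<D>" "\<D> \<subseteq> \<C> - {{?e}}" "\<Union>\<D> = (\<Pi>\<^sub>E i\<in>I. carrier (G i))"
        using finite_box_subcover[of I G T, OF assms _ cover'] box by blast
      then show ?thesis by (intro exI[of _ \<D>]) auto
    qed
  qed
qed

end
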